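(* There exists a finite dimensional asymmetric normed space $(X,q)$ such that the closed unit ball $B_1^q[0]$ is compact (in the topology $\tau_q$), but not strongly compact.
   Context: An asymmetric norm on a real linear space $X$ is a function $q:X\to[0,\infty)$ such that (i) $q(ax)=a\,q(x)$ for all $x\in X$, $a\ge 0$; (ii) $q(x+y)\le q(x)+q(y)$ for all $x,y\in X$; (iii) if $q(x)=q(-x)=0$ then $x=0$. The pair $(X,q)$ is an asymmetric normed space. The topology $\tau_q$ is generated by the open balls $B^q_\varepsilon(x)=\{y\in X: q(y-x)<\varepsilon\}$. The closed ball is $B^q_\varepsilon[x]=\{y\in X: q(y-x)\le\varepsilon\}$. Let $\theta_q=\{x\in X: q(x)=0\}$ and let $q^s(x)=\max\{q(x),q(-x)\}$, which is a norm on $X$. "$q^s$-compact" means compact in the topology of the norm $q^s$. A set $K\subset X$ is strongly compact if there is a $q^s$-compact set $S\subset X$ with $S\subset K\subset S+\theta_q$. *)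

theory Defs
  imports "HOL-Analysis.Analysis" "HOL-Analysis.Finite_Function_Topology"
begin

text \<open>
  A real linear space is a linear subspace \<open>X\<close> of an ambient type of class \<open>real_vector\<close>, so that
  statements can quantify over spaces and their dimensions; up to linear isomorphism, every
  finite-dimensional space occurs in the type \<open>nat \<Rightarrow>\<^sub>0 real\<close> of finitely supported sequences.
  Only the values of \<open>q\<close> on \<open>X\<close> matter.
\<close>

definition asym_normed_space :: "'a::real_vector set \<Rightarrow> ('a \<Rightarrow> real) \<Rightarrow> bool" where
  "asym_normed_space X q \<longleftrightarrow>
     subspace X \<and>
     (\<forall>x\<in>X. 0 \<le> q x) \<and>
     (\<forall>x\<in>X. \<forall>a\<ge>0. q (a *\<^sub>R x) = a * q x) \<and>
     (\<forall>x\<in>X. \<forall>y\<in>X. q (x + y) \<le> q x + q y) \<and>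
     (\<forall>x\<in>X. q x = 0 \<and> q (- x) = 0 \<longrightarrow> x = 0)"

definition finite_dimensional :: "'a::real_vector set \<Rightarrow> bool" where
  "finite_dimensional X \<longleftrightarrow> (\<exists>B. finite B \<and> span B = X)"

definition asym_ball :: "'a::real_vector set \<Rightarrow> ('a \<Rightarrow> real) \<Rightarrow> 'a \<Rightarrow> real \<Rightarrow> 'a set" where
  "asym_ball X q x \<epsilon> = {y \<in> X. q (y - x) < \<epsilon>}"

definition asym_cball :: "'a::real_vector set \<Rightarrow> ('a \<Rightarrow> real) \<Rightarrow> 'a \<Rightarrow> real \<Rightarrow> 'a set" where
  "asym_cball X q x \<epsilon> = {y \<in> X. q (y - x) \<le> \<epsilon>}"

definition asym_topology :: "'a::real_vector set \<Rightarrow> ('a \<Rightarrow> real) \<Rightarrow> 'a topology" where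
  "asym_topology X q = topology_generated_by {asym_ball X q x \<epsilon> | x \<epsilon>. x \<in> X \<and> \<epsilon> > 0}"

definition asym_theta :: "'a::real_vector set \<Rightarrow> ('a \<Rightarrow> real) \<Rightarrow> 'a set" where
  "asym_theta X q = {x \<in> X. q x = 0}"

definition sym_norm :: "('a::real_vector \<Rightarrow> real) \<Rightarrow> 'a \<Rightarrow> real" where
  "sym_norm q x = max (q x) (q (- x))"

text \<open>
  The topology of the norm \<open>sym_norm q\<close> on \<open>X\<close> is \<open>asym_topology X (sym_norm q)\<close>; lemma
  \<open>asym_topology_sym_norm\<close> below identifies it with the usual metric topology.
  The sum of sets is the Minkowski sum of \<open>HOL-Library.Set_Algebras\<close>.
\<close>

definition strongly_compact :: "'a::real_vector set \<Rightarrow> ('a \<Rightarrow> real) \<Rightarrow> 'a set \<Rightarrow> bool" where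
  "strongly_compact X q K \<longleftrightarrow>
     K \<subseteq> X \<and>
     (\<exists>S. compactin (asym_topology X (sym_norm q)) S \<and> S \<subseteq> K \<and> K \<subseteq> S + asym_theta X q)"

text \<open>
  The absolute value is redundant on \<open>X\<close>; \<open>Metric_space\<close> demands nonnegativity also outside the carrier.
\<close>

lemma Metric_space_sym_norm:
  assumes "asym_normed_space X q"
  shows "Metric_space X (\<lambda>x y. \<bar>sym_norm q (y - x)\<bar>)"
proof -
  have X: "subspace X" and nonneg: "\<And>x. x \<in> X \<Longrightarrow> 0 \<le> q x"
    and hom: "\<And>x a. x \<in> X \<Longrightarrow> a \<ge> 0 \<Longrightarrow> q (a *\<^sub>R x) = a * q x"
    and tri: "\<And>x y. x \<in> X \<Longrightarrow> y \<in> X \<Longrightarrow> q (x + y) \<le> q x + q y"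
    and zero: "\<And>x. x \<in> X \<Longrightarrow> q x = 0 \<Longrightarrow> q (- x) = 0 \<Longrightarrow> x = 0"
    using assms unfolding asym_normed_space_def by auto
  have q0: "q 0 = 0" using hom[of 0 0] X by (simp add: subspace_0)
  show ?thesis
  proof
    fix x y
    show "0 \<le> \<bar>sym_norm q (y - x)\<bar>" by simp
    show "\<bar>sym_norm q (y - x)\<bar> = \<bar>sym_norm q (x - y)\<bar>"
      by (simp add: sym_norm_def max.commute)
  next
    fix x y assume xy: "x \<in> X" "y \<in> X"
    then have d: "y - x \<in> X" "x - y \<in> X" using X by (simp_all add: subspace_diff)
    show "(\<bar>sym_norm q (y - x)\<bar> = 0) = (x = y)"
    proof
      assume "\<bar>sym_norm q (y - x)\<bar> = 0"
      then have "max (q (y - x)) (q (x - y)) = 0" by (simp add: sym_norm_def)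
      then have "q (y - x) = 0" "q (x - y) = 0"
        using nonneg[OF d(1)] nonneg[OF d(2)] by linarith+
      then show "x = y" using zero[OF d(1)] by simp
    qed (simp add: sym_norm_def q0)
  next
    fix x y z assume xyz: "x \<in> X" "y \<in> X" "z \<in> X"
    have 1: "y - x \<in> X" "z - y \<in> X" "x - y \<in> X" "y - z \<in> X" "x - z \<in> X" "z - x \<in> X"
      using xyz X by (simp_all add: subspace_diff)
    have "q (z - x) \<le> q (z - y) + q (y - x)" "q (x - z) \<le> q (x - y) + q (y - z)"
      using tri[OF 1(2,1)] tri[OF 1(3,4)] by simp_all
    then show "\<bar>sym_norm q (z - x)\<bar> \<le> \<bar>sym_norm q (y - x)\<bar> + \<bar>sym_norm q (z - y)\<bar>"
      using 1[THEN nonneg] unfolding sym_norm_def minus_diff_eq by linarith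
  qed
qed

lemma asym_topology_sym_norm:
  assumes "asym_normed_space X q"
  shows "asym_topology X (sym_norm q) = Metric_space.mtopology X (\<lambda>x y. \<bar>sym_norm q (y - x)\<bar>)"
    (is "_ = Metric_space.mtopology X ?d")
proof -
  interpret Metric_space X ?d by (rule Metric_space_sym_norm[OF assms])
  have X: "subspace X" and nonneg: "\<And>x. x \<in> X \<Longrightarrow> 0 \<le> q x"
    using assms unfolding asym_normed_space_def by auto
  have ball: "asym_ball X (sym_norm q) x e = mball x e" if x: "x \<in> X" for x e
  proof -
    have "\<bar>sym_norm q (y - x)\<bar> = sym_norm q (y - x)" if "y \<in> X" for y
      using nonneg[of "y - x"] that x X by (simp add: sym_norm_def subspace_diff le_max_iff_disj)
    then show ?thesis using x unfolding asym_ball_def mball_def by (metis (lifting))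
  qed
  let ?B = "{asym_ball X (sym_norm q) x e | x e. x \<in> X \<and> e > 0}"
  show ?thesis
  proof (rule topology_eq[THEN iffD2], intro allI iffI)
    fix U assume "openin (asym_topology X (sym_norm q)) U"
    then have "generate_topology_on ?B U"
      by (simp only: asym_topology_def openin_topology_generated_by_iff)
    then show "openin mtopology U"
    proof induction
      case (Basis s)
      then obtain x e where "x \<in> X" "s = asym_ball X (sym_norm q) x e" by blast
      then show ?case by (simp only: ball openin_mball)
    next
      case (UN K)
      then show ?case by (intro openin_Union)
    qed (simp_all only: openin_empty openin_Int)
  next
    fix U assume U: "openin mtopology U"
    have "\<exists>T. openin (asym_topology X (sym_norm q)) T \<and> x \<in> T \<and> T \<subseteq> U" if x: "x \<in> U" for x
    proof -
      have xX: "x \<in> X" using U x unfolding openin_mtopology by (elim conjE subsetD)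
      have "\<exists>r>0. mball x r \<subseteq> U" using U x unfolding openin_mtopology by simp
      then obtain r where r: "r > 0" "mball x r \<subseteq> U" by (elim exE conjE)
      have "openin (asym_topology X (sym_norm q)) (asym_ball X (sym_norm q) x r)"
        unfolding asym_topology_def using r(1) xX
        by (intro topology_generated_by_Basis) blast
      moreover have "x \<in> mball x r" using r(1) xX by (simp only: centre_in_mball_iff)
      ultimately show ?thesis using r(2) ball[OF xX] by (intro exI[of _ "mball x r"]) simp
    qed
    then show "openin (asym_topology X (sym_norm q)) U"
      by (subst openin_subopen) (intro ballI)
  qed
qed

end

theory Submission
  imports Defs
begin

text \<open>
  In \<open>\<real>\<^sup>3\<close> take the convex set
  \<open>B = {(x, y, z). x^4 + y^4 \<le> 1 \<and> x\<^sup>2 \<le> (1 + y) * (1 + z) \<and> - 1 \<le> z}\<close>,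
  the epigraph of \<open>f (x, y) = x\<^sup>2 / (1 + y) - 1\<close> over the disc \<open>D\<close> given by \<open>x^4 + y^4 \<le> 1\<close>, where
  \<open>f (0, - 1) = - 1\<close>. It has the origin in its interior and its only directions of recession are
  \<open>(0, 0, z)\<close> with \<open>z \<ge> 0\<close>, so its Minkowski functional is an asymmetric norm \<open>q\<close> whose null cone
  \<open>\<theta>\<close> is the upper half of the \<open>z\<close>-axis.

  The function \<open>f\<close> is finite and lower semicontinuous on the compact set \<open>D\<close>, but unbounded: near
  \<open>(0, - 1)\<close> the boundary of \<open>D\<close> is so flat, \<open>1 + y \<approx> x^4 / 4\<close>, that \<open>f\<close> grows like \<open>4 / x\<^sup>2\<close> along it
  (\<open>lower_height_unbounded\<close>). A curved boundary as that of the Euclidean disc would keep \<open>f\<close> bounded.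

  Unboundedness refutes strong compactness: if \<open>S \<subseteq> B \<subseteq> S + \<theta>\<close>, then every lowest point
  \<open>(x, y, f (x, y))\<close> of \<open>B\<close> belongs to \<open>S\<close>, since adding an element of \<open>\<theta>\<close> only raises a point; so
  \<open>S\<close> is unbounded.

  Lower semicontinuity gives compactness in \<open>\<tau>\<^sub>q\<close>: a neighbourhood of the lowest point over
  \<open>p \<in> D\<close> contains all points of \<open>B\<close> over a neighbourhood of \<open>p\<close>, because going up costs nothing
  in \<open>q\<close> (\<open>skew_norm_diff_lower_height_le\<close>). Hence a finite subcover for \<open>D\<close> yields one for \<open>B\<close>.
\<close>

section \<open>An asymmetric norm on three coordinates\<close>

lemma sqrt_sqrt_power4: "sqrt (sqrt (u^4)) = \<bar>u\<bar>"
proof -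
  have "u^4 = (u\<^sup>2)\<^sup>2"
    by (simp flip: power_mult)
  then show ?thesis
    by (simp only: real_sqrt_abs abs_power2)
qed

text \<open>
  Minkowski's inequality for exponent 4: each mixed term of the binomial expansion is bounded by
  the Cauchy--Schwarz inequality, applied to \<open>(a\<^sup>2, b\<^sup>2)\<close> and \<open>(c\<^sup>2, d\<^sup>2)\<close> first and then to
  \<open>(a\<^sup>2, b\<^sup>2)\<close> and \<open>(a * c, b * d)\<close>.
\<close>

lemma l4_triangle:
  fixes a b c d :: real
  shows "sqrt (sqrt ((a + c)^4 + (b + d)^4)) \<le> sqrt (sqrt (a^4 + b^4)) + sqrt (sqrt (c^4 + d^4))"
proof -
  define A where "A = sqrt (sqrt (a^4 + b^4))"
  define C where "C = sqrt (sqrt (c^4 + d^4))"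
  have nonneg: "0 \<le> A" "0 \<le> C"
    by (simp_all add: A_def C_def)
  have A2: "sqrt (a^4 + b^4) = A\<^sup>2" and C2: "sqrt (c^4 + d^4) = C\<^sup>2"
    by (simp_all add: A_def C_def)
  have A4: "a^4 + b^4 = A^4"
    using A2 by (metis add_nonneg_nonneg even_numeral power2_eq_square power4_eq_xxxx mult.assoc
        real_sqrt_pow2 zero_le_even_power)
  have C4: "c^4 + d^4 = C^4"
    using C2 by (metis add_nonneg_nonneg even_numeral power2_eq_square power4_eq_xxxx mult.assoc
        real_sqrt_pow2 zero_le_even_power)
  have cs: "u * v + w * z \<le> sqrt (u\<^sup>2 + w\<^sup>2) * sqrt (v\<^sup>2 + z\<^sup>2)" for u v w z :: real
    using Cauchy_Schwarz_ineq2[of "Complex u w" "Complex v z"] 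
    by (simp add: inner_complex_def complex_norm)
  have p4: "(u\<^sup>2)\<^sup>2 = u^4" for u :: real
    by (simp flip: power_mult)
  have middle: "a\<^sup>2 * c\<^sup>2 + b\<^sup>2 * d\<^sup>2 \<le> A\<^sup>2 * C\<^sup>2"
    using cs[of "a\<^sup>2" "c\<^sup>2" "b\<^sup>2" "d\<^sup>2"] by (simp add: p4 A2 C2)
  then have "sqrt ((a * c)\<^sup>2 + (b * d)\<^sup>2) \<le> sqrt ((A * C)\<^sup>2)"
    by (intro real_sqrt_le_mono) (simp add: power_mult_distrib)
  then have prod: "sqrt ((a * c)\<^sup>2 + (b * d)\<^sup>2) \<le> A * C"
    using nonneg by simp
  have "a\<^sup>2 * (a * c) + b\<^sup>2 * (b * d) \<le> A\<^sup>2 * sqrt ((a * c)\<^sup>2 + (b * d)\<^sup>2)"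
    using cs[of "a\<^sup>2" "a * c" "b\<^sup>2" "b * d"] by (simp add: p4 A2)
  also have "\<dots> \<le> A\<^sup>2 * (A * C)"
    by (intro mult_left_mono prod) simp
  finally have left: "a\<^sup>2 * (a * c) + b\<^sup>2 * (b * d) \<le> A\<^sup>2 * (A * C)" .
  have "c\<^sup>2 * (a * c) + d\<^sup>2 * (b * d) \<le> C\<^sup>2 * sqrt ((a * c)\<^sup>2 + (b * d)\<^sup>2)"
    using cs[of "c\<^sup>2" "a * c" "d\<^sup>2" "b * d"] by (simp add: p4 C2)
  also have "\<dots> \<le> C\<^sup>2 * (A * C)"
    by (intro mult_left_mono prod) simp
  finally have right: "c\<^sup>2 * (a * c) + d\<^sup>2 * (b * d) \<le> C\<^sup>2 * (A * C)" .
  have expand: "(u + v)^4 = u^4 + 4 * (u\<^sup>2 * (u * v)) + 6 * (u\<^sup>2 * v\<^sup>2) + 4 * (v\<^sup>2 * (u * v)) + v^4"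
    for u v :: real
    by (simp add: power2_eq_square power4_eq_xxxx algebra_simps)
  have "(a + c)^4 + (b + d)^4 \<le> (A + C)^4"
    unfolding expand using A4 C4 left middle right by (simp add: algebra_simps)
  then have "sqrt (sqrt ((a + c)^4 + (b + d)^4)) \<le> sqrt (sqrt ((A + C)^4))"
    by (intro real_sqrt_le_mono)
  also have "\<dots> = A + C"
    using nonneg by (simp add: sqrt_sqrt_power4)
  finally show ?thesis
    by (simp add: A_def C_def)
qed

text \<open>
  The second argument of the maximum is the Minkowski functional of the region bounded by a circular
  cone with apex \<open>(0, - 1, - 1)\<close>: with \<open>u = (y - z) / 2\<close> and \<open>v = (y + z) / 2\<close> the region is
  \<open>sqrt (x\<^sup>2 + u\<^sup>2) \<le> 1 + v\<close>, and \<open>(1 + v)\<^sup>2 - u\<^sup>2 = (1 + y) * (1 + z)\<close>.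
\<close>

definition skew_norm :: "real \<Rightarrow> real \<Rightarrow> real \<Rightarrow> real" where
  "skew_norm x y z =
     max (sqrt (sqrt (x^4 + y^4))) (sqrt (x\<^sup>2 + ((y - z) / 2)\<^sup>2) - (y + z) / 2)"

lemma skew_norm_nonneg: "0 \<le> skew_norm x y z"
  by (simp add: skew_norm_def le_max_iff_disj)

lemma skew_norm_scale:
  assumes "0 \<le> a"
  shows "skew_norm (a * x) (a * y) (a * z) = a * skew_norm x y z"
proof -
  have "(a * x)^4 + (a * y)^4 = a^4 * (x^4 + y^4)"
    by (simp add: power_mult_distrib distrib_left)
  then have "sqrt (sqrt ((a * x)^4 + (a * y)^4)) = a * sqrt (sqrt (x^4 + y^4))"
    using assms by (simp only: real_sqrt_mult sqrt_sqrt_power4 abs_of_nonneg)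
  moreover have "(a * x)\<^sup>2 + ((a * y - a * z) / 2)\<^sup>2 = a\<^sup>2 * (x\<^sup>2 + ((y - z) / 2)\<^sup>2)"
    by (simp add: power2_eq_square field_simps)
  then have "sqrt ((a * x)\<^sup>2 + ((a * y - a * z) / 2)\<^sup>2) = a * sqrt (x\<^sup>2 + ((y - z) / 2)\<^sup>2)"
    using assms by (simp add: real_sqrt_mult)
  ultimately show ?thesis
    using assms by (simp add: skew_norm_def max_mult_distrib_left algebra_simps)
qed

lemma skew_norm_triangle: "skew_norm (x + x') (y + y') (z + z') \<le> skew_norm x y z + skew_norm x' y' z'"
proof -
  have "sqrt ((x + x')\<^sup>2 + ((y + y' - (z + z')) / 2)\<^sup>2)
      \<le> sqrt (x\<^sup>2 + ((y - z) / 2)\<^sup>2) + sqrt (x'\<^sup>2 + ((y' - z') / 2)\<^sup>2)"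
    using real_sqrt_sum_squares_triangle_ineq[of x x' "(y - z) / 2" "(y' - z') / 2"]
    by (simp add: algebra_simps add_divide_distrib diff_divide_distrib)
  then have "sqrt ((x + x')\<^sup>2 + ((y + y' - (z + z')) / 2)\<^sup>2) - (y + y' + (z + z')) / 2
      \<le> (sqrt (x\<^sup>2 + ((y - z) / 2)\<^sup>2) - (y + z) / 2) + (sqrt (x'\<^sup>2 + ((y' - z') / 2)\<^sup>2) - (y' + z') / 2)"
    by (simp add: field_simps)
  then show ?thesis
    using l4_triangle[of x x' y y'] unfolding skew_norm_def by linarith
qed

lemma skew_norm_eq_0_iff: "skew_norm x y z = 0 \<longleftrightarrow> x = 0 \<and> y = 0 \<and> 0 \<le> z"
proof
  assume 0: "skew_norm x y z = 0"
  have "sqrt (sqrt (x^4 + y^4)) \<le> 0"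
    unfolding 0[symmetric] skew_norm_def by simp
  then have "x^4 + y^4 \<le> 0"
    by simp
  moreover have "0 \<le> x^4" "0 \<le> y^4"
    by simp_all
  ultimately have "x^4 = 0" "y^4 = 0"
    by linarith+
  then have xy: "x = 0" "y = 0"
    by simp_all
  have "sqrt (x\<^sup>2 + ((y - z) / 2)\<^sup>2) - (y + z) / 2 \<le> 0"
    unfolding 0[symmetric] skew_norm_def by simp
  then have "\<bar>z / 2\<bar> \<le> z / 2"
    unfolding xy by simp
  with xy show "x = 0 \<and> y = 0 \<and> 0 \<le> z"
    by simp
qed (simp add: skew_norm_def)

text \<open>
  Only a descent in \<open>z\<close> contributes to the bound, so a point lying high above a given one is near it
  as soon as their horizontal coordinates are.
\<close>

lemma skew_norm_le_abs: "skew_norm x y z \<le> \<bar>x\<bar> + \<bar>y\<bar> + max 0 (- z)"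
proof -
  have "sqrt (sqrt (x^4 + y^4)) \<le> \<bar>x\<bar> + \<bar>y\<bar>"
    using l4_triangle[of x 0 0 y] by (simp add: sqrt_sqrt_power4)
  moreover have "sqrt (x\<^sup>2 + ((y - z) / 2)\<^sup>2) \<le> \<bar>x\<bar> + \<bar>(y - z) / 2\<bar>"
    by (rule sqrt_sum_squares_le_sum_abs)
  ultimately show ?thesis
    unfolding skew_norm_def by (simp add: abs_if max_def field_simps split: if_splits)
qed

section \<open>The unit ball as an epigraph\<close>

lemma abs_le_1_if_power4_sum_le_1:
  fixes x y :: real
  assumes "x^4 + y^4 \<le> 1"
  shows "\<bar>x\<bar> \<le> 1" and "\<bar>y\<bar> \<le> 1"
proof -
  have "0 \<le> x^4" "0 \<le> y^4"
    by simp_all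
  with assms have "x^4 \<le> 1" "y^4 \<le> 1"
    by linarith+
  then have "sqrt (sqrt (x^4)) \<le> 1" "sqrt (sqrt (y^4)) \<le> 1"
    by simp_all
  then show "\<bar>x\<bar> \<le> 1" and "\<bar>y\<bar> \<le> 1"
    by (simp_all only: sqrt_sqrt_power4)
qed

lemma skew_norm_le_1_iff:
  "skew_norm x y z \<le> 1 \<longleftrightarrow> x^4 + y^4 \<le> 1 \<and> x\<^sup>2 \<le> (1 + y) * (1 + z) \<and> - 1 \<le> z"
proof -
  have eq: "(1 + (y + z) / 2)\<^sup>2 - ((y - z) / 2)\<^sup>2 = (1 + y) * (1 + z)"
    by (simp add: power2_eq_square field_simps)
  have "sqrt (x\<^sup>2 + ((y - z) / 2)\<^sup>2) \<le> 1 + (y + z) / 2 \<longleftrightarrow> x\<^sup>2 \<le> (1 + y) * (1 + z) \<and> - 1 \<le> z"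
    if y: "- 1 \<le> y"
  proof
    assume L: "sqrt (x\<^sup>2 + ((y - z) / 2)\<^sup>2) \<le> 1 + (y + z) / 2"
    then have "x\<^sup>2 + ((y - z) / 2)\<^sup>2 \<le> (1 + (y + z) / 2)\<^sup>2"
      by (rule sqrt_le_D)
    moreover have "\<bar>(y - z) / 2\<bar> \<le> sqrt (x\<^sup>2 + ((y - z) / 2)\<^sup>2)"
      by (simp flip: real_sqrt_abs)
    then have "(y - z) / 2 \<le> 1 + (y + z) / 2"
      using L by linarith
    then have "- 1 \<le> z"
      by (simp add: field_simps)
    ultimately show "x\<^sup>2 \<le> (1 + y) * (1 + z) \<and> - 1 \<le> z"
      using eq by linarith
  next
    assume R: "x\<^sup>2 \<le> (1 + y) * (1 + z) \<and> - 1 \<le> z"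
    show "sqrt (x\<^sup>2 + ((y - z) / 2)\<^sup>2) \<le> 1 + (y + z) / 2"
    proof (rule real_le_lsqrt)
      show "0 \<le> 1 + (y + z) / 2"
        using y R by (simp add: field_simps)
      show "x\<^sup>2 + ((y - z) / 2)\<^sup>2 \<le> (1 + (y + z) / 2)\<^sup>2"
        using R eq by linarith
    qed
  qed
  moreover have "- 1 \<le> y" if "x^4 + y^4 \<le> 1"
    using abs_le_1_if_power4_sum_le_1(2)[OF that] by linarith
  moreover have "skew_norm x y z \<le> 1 \<longleftrightarrow>
      x^4 + y^4 \<le> 1 \<and> sqrt (x\<^sup>2 + ((y - z) / 2)\<^sup>2) \<le> 1 + (y + z) / 2"
    unfolding skew_norm_def by auto
  ultimately show ?thesis
    by blast
qed

text \<open>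
  On the disc \<open>x^4 + y^4 \<le> 1\<close> the denominator vanishes only at \<open>(0, - 1)\<close>, where division by zero
  gives the value \<open>- 1\<close> that the unit ball requires there.
\<close>

definition lower_height :: "real \<Rightarrow> real \<Rightarrow> real" where
  "lower_height x y = x\<^sup>2 / (1 + y) - 1"

text \<open>
  The affine minorants \<open>2 * t * x - t\<^sup>2 * (1 + y) - 1\<close> are the tangent planes of the cone, and the
  slope \<open>t = x / (1 + y)\<close> touches the graph. The identity also holds at \<open>(0, - 1)\<close>, with \<open>t = 0\<close>; so
  the singular point of the boundary needs no separate treatment.
\<close>

lemma lower_height_tangent: "lower_height x y = 2 * (x / (1 + y)) * x - (x / (1 + y))\<^sup>2 * (1 + y) - 1"
  by (cases "1 + y = 0") (simp_all add: lower_height_def power2_eq_square)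

text \<open>
  By the cone inequality \<open>2 * t * x\<close> is at most \<open>2 * \<bar>t\<bar> * sqrt ((1 + y) * (1 + z))\<close>, and the
  arithmetic-geometric mean inequality splits the latter.
\<close>

lemma unit_ball_above_tangent:
  assumes "skew_norm x y z \<le> 1"
  shows "2 * t * x - t\<^sup>2 * (1 + y) - 1 \<le> z"
proof -
  have B: "x\<^sup>2 \<le> (1 + y) * (1 + z)" "0 \<le> 1 + y" "0 \<le> 1 + z"
    using assms abs_le_1_if_power4_sum_le_1(2)[of x y] by (auto simp: skew_norm_le_1_iff)
  define r s where "r = sqrt (1 + y)" and "s = sqrt (1 + z)"
  have "\<bar>x\<bar> \<le> r * s"
    using real_sqrt_le_mono[OF B(1)] by (simp add: r_def s_def real_sqrt_mult)
  then have "\<bar>t\<bar> * \<bar>x\<bar> \<le> \<bar>t\<bar> * (r * s)"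
    by (intro mult_left_mono) auto
  moreover have "t * x \<le> \<bar>t\<bar> * \<bar>x\<bar>"
    by (metis abs_ge_self abs_mult)
  moreover have "0 \<le> (\<bar>t\<bar> * r - s)\<^sup>2"
    by simp
  then have "2 * (\<bar>t\<bar> * (r * s)) \<le> t\<^sup>2 * (1 + y) + (1 + z)"
    using B by (simp add: power2_diff power_mult_distrib r_def s_def mult_ac)
  ultimately show ?thesis
    by linarith
qed

lemma lower_height_in_unit_ball:
  assumes "x^4 + y^4 \<le> 1"
  shows "skew_norm x y (lower_height x y) \<le> 1"
proof -
  have y: "- 1 \<le> y"
    using abs_le_1_if_power4_sum_le_1(2)[OF assms] by linarith
  have "x = 0" if "y = - 1"
  proof -
    have "0 \<le> x^4" by simp
    then have "x^4 = 0" using assms that by simp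
    then show ?thesis by simp
  qed
  then have "x\<^sup>2 \<le> (1 + y) * (1 + lower_height x y)"
    by (cases "y = - 1") (auto simp: lower_height_def)
  moreover have "- 1 \<le> lower_height x y"
    using y by (simp add: lower_height_def)
  ultimately show ?thesis
    using assms by (simp add: skew_norm_le_1_iff)
qed

text \<open>
  Lower semicontinuity in quantitative form: a point of the unit ball lies above the tangent plane
  at \<open>(x, y)\<close>, so it can drop below the height at \<open>(x, y)\<close> by a linear term in the horizontal
  distance at most. The height \<open>z'\<close> does not enter the bound.
\<close>

lemma skew_norm_diff_lower_height_le:
  fixes x y x' y' z' :: real
  defines "t \<equiv> x / (1 + y)"
  assumes "skew_norm x' y' z' \<le> 1"
  shows "skew_norm (x' - x) (y' - y) (z' - lower_height x y)
      \<le> (1 + 2 * \<bar>t\<bar>) * \<bar>x' - x\<bar> + (1 + t\<^sup>2) * \<bar>y' - y\<bar>"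
proof -
  have "lower_height x y - z' \<le> 2 * t * (x - x') - t\<^sup>2 * (y - y')"
    using unit_ball_above_tangent[OF assms(2), of t] lower_height_tangent[of x y, folded t_def] by (simp add: algebra_simps)
  also have "\<dots> \<le> \<bar>2 * t * (x - x')\<bar> + \<bar>t\<^sup>2 * (y - y')\<bar>"
    by linarith
  also have "\<dots> = 2 * \<bar>t\<bar> * \<bar>x' - x\<bar> + t\<^sup>2 * \<bar>y' - y\<bar>"
    by (simp add: abs_mult abs_minus_commute)
  finally have "max 0 (- (z' - lower_height x y)) \<le> 2 * \<bar>t\<bar> * \<bar>x' - x\<bar> + t\<^sup>2 * \<bar>y' - y\<bar>"
    by simp
  then show ?thesis
    using skew_norm_le_abs[of "x' - x" "y' - y" "z' - lower_height x y"]
    unfolding distrib_right mult_1_left by linarith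
qed

text \<open>
  On the boundary \<open>x^4 + y^4 = 1\<close> with \<open>y < 0\<close> one has \<open>1 + y \<le> x^4\<close>, so the height there is at least
  \<open>1 / x\<^sup>2 - 1\<close>; the witness has \<open>x\<^sup>2 = 1 / K\<close> with \<open>K \<ge> M + 2\<close>.
\<close>

lemma lower_height_unbounded: "\<exists>x y. x^4 + y^4 \<le> 1 \<and> M < lower_height x y"
proof -
  define K where "K = max (M + 2) 2"
  have K: "M + 2 \<le> K" "2 \<le> K"
    by (simp_all add: K_def)
  define s where "s = 1 / K"
  have s: "0 < s" "s < 1" "0 < s\<^sup>2" "s\<^sup>2 < 1"
    using K by (simp_all add: s_def power_less_one_iff field_simps)
  define r where "r = sqrt (sqrt (1 - s\<^sup>2))"
  have r: "0 \<le> r" "r < 1"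
    using s by (simp_all add: r_def)
  have r4: "r^4 = 1 - s\<^sup>2"
  proof -
    have "r^4 = (r\<^sup>2)\<^sup>2"
      by (simp flip: power_mult)
    also have "\<dots> = 1 - s\<^sup>2"
      using s by (simp add: r_def)
    finally show ?thesis .
  qed
  have "r^4 \<le> r"
    using power_decreasing[of 1 4 r] r by simp
  then have "1 - r \<le> s\<^sup>2"
    using r4 by linarith
  then have "s / s\<^sup>2 \<le> s / (1 - r)"
    using s r by (intro divide_left_mono) auto
  moreover have "s / s\<^sup>2 = K"
    using K by (simp add: s_def power2_eq_square)
  moreover have "lower_height (sqrt s) (- r) = s / (1 - r) - 1"
    using s by (simp add: lower_height_def)
  ultimately have "M < lower_height (sqrt s) (- r)"
    using K by linarith
  moreover have "sqrt s ^ 4 = s\<^sup>2"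
    using s power_mult[of "sqrt s" 2 2] by simp
  then have "sqrt s ^ 4 + (- r)^4 \<le> 1"
    using r4 by simp
  ultimately show ?thesis
    by blast
qed

section \<open>Open sets of an asymmetric normed space\<close>

text \<open>
  The balls are a base and not only a subbase: by the triangle inequality a ball contains a smaller
  ball around each of its points. The induction follows the generation of the topology.
\<close>

lemma openin_asym_topology_imp_ball:
  assumes X: "asym_normed_space X q" and U: "openin (asym_topology X q) U" and x: "x \<in> U"
  shows "\<exists>\<epsilon>>0. asym_ball X q x \<epsilon> \<subseteq> U"
proof -
  have sub: "subspace X"
    and tri: "\<And>x y. x \<in> X \<Longrightarrow> y \<in> X \<Longrightarrow> q (x + y) \<le> q x + q y"
    using X unfolding asym_normed_space_def by auto
  have "generate_topology_on {asym_ball X q x \<epsilon> | x \<epsilon>. x \<in> X \<and> \<epsilon> > 0} U"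
    using U by (simp only: asym_topology_def openin_topology_generated_by_iff)
  then show ?thesis
    using x
  proof induction
    case (Int U V)
    then obtain d e where "d > 0" "asym_ball X q x d \<subseteq> U" "e > 0" "asym_ball X q x e \<subseteq> V"
      by blast
    then show ?case
      by (intro exI[of _ "min d e"]) (auto simp: asym_ball_def)
  next
    case (UN K)
    then show ?case
      by (meson Union_iff Sup_upper order_trans)
  next
    case (Basis U)
    then obtain c e where c: "c \<in> X" and U: "U = asym_ball X q c e"
      by blast
    have x: "x \<in> X" "q (x - c) < e"
      using Basis U by (auto simp: asym_ball_def)
    have "q (y - c) < e" if "y \<in> X" "q (y - x) < e - q (x - c)" for y
      using tri[of "y - x" "x - c"] that x c sub by (simp add: subspace_diff)
    then show ?case
      using x U by (intro exI[of _ "e - q (x - c)"]) (auto simp: asym_ball_def)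
  qed simp
qed

lemma topspace_asym_topology:
  assumes X: "asym_normed_space X q"
  shows "topspace (asym_topology X q) = X"
proof
  show "topspace (asym_topology X q) \<subseteq> X"
    unfolding asym_topology_def topology_generated_by_topspace by (auto simp: asym_ball_def)
  have "0 \<in> X" and hom: "\<forall>x\<in>X. \<forall>a\<ge>0. q (a *\<^sub>R x) = a * q x"
    using X unfolding asym_normed_space_def by (simp_all add: subspace_0)
  then have "q (0 *\<^sub>R 0) = 0 * q 0"
    by (meson order_refl)
  then have "q 0 = 0"
    by simp
  show "X \<subseteq> topspace (asym_topology X q)"
  proof
    fix x assume "x \<in> X"
    then have "x \<in> asym_ball X q x 1"
      using \<open>q 0 = 0\<close> by (simp add: asym_ball_def)
    then show "x \<in> topspace (asym_topology X q)"
      unfolding asym_topology_def topology_generated_by_topspace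
      using \<open>x \<in> X\<close>
      by (intro UnionI[of "asym_ball X q x 1"] CollectI exI[of _ x] exI[of _ 1]) simp_all
  qed
qed

section \<open>The three-dimensional example\<close>

definition point :: "real \<Rightarrow> real \<Rightarrow> real \<Rightarrow> nat \<Rightarrow>\<^sub>0 real" where
  "point x y z = Poly_Mapping.single 0 x + Poly_Mapping.single 1 y + Poly_Mapping.single 2 z"

definition space3 :: "(nat \<Rightarrow>\<^sub>0 real) set" where
  "space3 = {point x y z | x y z. True}"

definition q3 :: "(nat \<Rightarrow>\<^sub>0 real) \<Rightarrow> real" where
  "q3 p = skew_norm (Poly_Mapping.lookup p 0) (Poly_Mapping.lookup p 1) (Poly_Mapping.lookup p 2)"

lemma q3_point [simp]: "q3 (point x y z) = skew_norm x y z"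
  by (simp add: q3_def point_def lookup_add lookup_single)

lemma point_eq_iff: "point x y z = point x' y' z' \<longleftrightarrow> x = x' \<and> y = y' \<and> z = z'"
proof
  assume "point x y z = point x' y' z'"
  then have "Poly_Mapping.lookup (point x y z) i = Poly_Mapping.lookup (point x' y' z') i" for i
    by simp
  from this[of 0] this[of 1] this[of 2] show "x = x' \<and> y = y' \<and> z = z'"
    by (simp_all add: point_def lookup_add lookup_single)
qed simp

lemma lookup_scaleR:
  fixes p :: "'a \<Rightarrow>\<^sub>0 'b::real_vector"
  shows "Poly_Mapping.lookup (a *\<^sub>R p) i = a *\<^sub>R Poly_Mapping.lookup p i"
proof -
  have "finite {i. a *\<^sub>R Poly_Mapping.lookup p i \<noteq> 0}"
    by (rule finite_subset[OF _ finite_lookup[of p]]) auto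
  then show ?thesis
    unfolding scaleR_poly_mapping_def by (subst lookup_Abs_poly_mapping) auto
qed

lemma point_linear:
  "point x y z + point x' y' z' = point (x + x') (y + y') (z + z')"
  "point x y z - point x' y' z' = point (x - x') (y - y') (z - z')"
  "- point x y z = point (- x) (- y) (- z)"
  "a *\<^sub>R point x y z = point (a * x) (a * y) (a * z)"
  "0 = point 0 0 0"
proof -
  show "point x y z + point x' y' z' = point (x + x') (y + y') (z + z')"
    by (simp add: point_def single_add algebra_simps)
  show "point x y z - point x' y' z' = point (x - x') (y - y') (z - z')"
    by (simp add: point_def single_diff algebra_simps)
  show "- point x y z = point (- x) (- y) (- z)"
    by (simp add: point_def single_uminus)
  show "a *\<^sub>R point x y z = point (a * x) (a * y) (a * z)"
    by (rule poly_mapping_eqI)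
      (simp add: point_def lookup_scaleR lookup_add lookup_single when_def algebra_simps)
  show "0 = point 0 0 0"
    by (simp add: point_def)
qed

lemma point_in_space3 [simp]: "point x y z \<in> space3"
  unfolding space3_def by blast

lemma space3_cases:
  assumes "p \<in> space3"
  obtains x y z where "p = point x y z"
  using assms unfolding space3_def by blast

lemma asym_normed_space_q3: "asym_normed_space space3 q3"
  unfolding asym_normed_space_def
proof (intro conjI ballI allI impI)
  show "subspace space3"
    unfolding subspace_def
    by (metis point_linear(1) point_linear(4) point_linear(5) point_in_space3 space3_cases)
  fix p assume "p \<in> space3"
  then obtain x y z where p: "p = point x y z"
    by (rule space3_cases)
  show "0 \<le> q3 p"
    by (simp only: p q3_point skew_norm_nonneg)
  show "q3 (a *\<^sub>R p) = a * q3 p" if "0 \<le> a" for a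
    using skew_norm_scale[OF that] by (simp only: p point_linear(4) q3_point)
  show "q3 (p + p') \<le> q3 p + q3 p'" if "p' \<in> space3" for p'
    using that by (elim space3_cases) (simp only: p point_linear(1) q3_point skew_norm_triangle)
  show "p = 0" if "q3 p = 0 \<and> q3 (- p) = 0"
    using that unfolding p point_linear(3) point_linear(5) q3_point skew_norm_eq_0_iff point_eq_iff
    by auto
qed

lemma finite_dimensional_space3: "finite_dimensional space3"
proof -
  let ?B = "{point 1 0 0, point 0 1 0, point 0 0 1}"
  have "span ?B = space3"
  proof
    have "subspace space3"
      using asym_normed_space_q3 unfolding asym_normed_space_def by blast
    then show "span ?B \<subseteq> space3"
      by (intro span_minimal) simp_all
    show "space3 \<subseteq> span ?B"
    proof
      fix p assume "p \<in> space3"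
      then obtain x y z where "p = point x y z"
        by (rule space3_cases)
      then have "p = x *\<^sub>R point 1 0 0 + y *\<^sub>R point 0 1 0 + z *\<^sub>R point 0 0 1"
        unfolding point_linear by simp
      also have "\<dots> \<in> span ?B"
        by (intro span_add span_scale span_base) simp_all
      finally show "p \<in> span ?B" .
    qed
  qed
  then show ?thesis
    unfolding finite_dimensional_def by (intro exI[of _ ?B]) simp
qed

lemma point_in_cball_iff: "point x y z \<in> asym_cball space3 q3 0 1 \<longleftrightarrow> skew_norm x y z \<le> 1"
  unfolding asym_cball_def by simp

text \<open>
  A tube argument. The open set chosen for the lowest point over \<open>p\<close> contains the whole part of the
  ball over the neighbourhood \<open>N p\<close>, and finitely many sets \<open>N p\<close> cover the compact disc.
\<close>

lemma compactin_q3_cball: "compactin (asym_topology space3 q3) (asym_cball space3 q3 0 1)"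
  unfolding compactin_def
proof (intro conjI allI impI)
  show "asym_cball space3 q3 0 1 \<subseteq> topspace (asym_topology space3 q3)"
    by (auto simp: topspace_asym_topology[OF asym_normed_space_q3] asym_cball_def)
next
  fix \<U>
  assume \<U>: "(\<forall>U\<in>\<U>. openin (asym_topology space3 q3) U) \<and> asym_cball space3 q3 0 1 \<subseteq> \<Union>\<U>"
  define D where "D = {p :: real \<times> real. fst p ^ 4 + snd p ^ 4 \<le> 1}"
  have "compact D"
    unfolding compact_eq_bounded_closed
  proof
    have "D \<subseteq> cbox (- 1) 1 \<times> cbox (- 1) 1"
    proof
      fix p assume "p \<in> D"
      then have "\<bar>fst p\<bar> \<le> 1" "\<bar>snd p\<bar> \<le> 1"
        using abs_le_1_if_power4_sum_le_1[of "fst p" "snd p"] by (simp_all add: D_def)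
      then show "p \<in> cbox (- 1) 1 \<times> cbox (- 1) 1"
        by (auto simp: abs_le_iff mem_Times_iff)
    qed
    then show "bounded D"
      by (rule bounded_subset[OF bounded_Times[OF bounded_cbox bounded_cbox], rotated])
    show "closed D"
      unfolding D_def by (intro closed_Collect_le continuous_intros)
  qed
  define base where "base p = point (fst p) (snd p) (lower_height (fst p) (snd p))" for p
  have "\<exists>U \<epsilon>. U \<in> \<U> \<and> \<epsilon> > 0 \<and> asym_ball space3 q3 (base p) \<epsilon> \<subseteq> U" if "p \<in> D" for p
  proof -
    have "base p \<in> asym_cball space3 q3 0 1"
      using that by (simp add: D_def base_def point_in_cball_iff lower_height_in_unit_ball)
    then have "base p \<in> \<Union>\<U>"
      using \<U> by (elim conjE) (rule subsetD)
    then obtain U where U: "U \<in> \<U>" "base p \<in> U"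
      by (rule UnionE)
    then have "openin (asym_topology space3 q3) U"
      using \<U> by simp
    from openin_asym_topology_imp_ball[OF asym_normed_space_q3 this U(2)] U(1) show ?thesis
      by metis
  qed
  then obtain U \<epsilon> where U: "\<And>p. p \<in> D \<Longrightarrow> U p \<in> \<U>" and \<epsilon>: "\<And>p. p \<in> D \<Longrightarrow> \<epsilon> p > 0"
      and ball: "\<And>p. p \<in> D \<Longrightarrow> asym_ball space3 q3 (base p) (\<epsilon> p) \<subseteq> U p"
    by metis
  define t where "t p = fst p / (1 + snd p)" for p :: "real \<times> real"
  define N where "N p = {p'. (1 + 2 * \<bar>t p\<bar>) * \<bar>fst p' - fst p\<bar>
      + (1 + (t p)\<^sup>2) * \<bar>snd p' - snd p\<bar> < \<epsilon> p}" for p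
  have "open (N p)" for p
    unfolding N_def by (intro open_Collect_less continuous_intros)
  moreover have "p \<in> N p" if "p \<in> D" for p
    using \<epsilon>[OF that] by (simp add: N_def)
  then have "D \<subseteq> (\<Union>p\<in>D. N p)"
    by blast
  ultimately obtain F where F: "F \<subseteq> D" "finite F" "D \<subseteq> (\<Union>p\<in>F. N p)"
    using compactE_image[OF \<open>compact D\<close>, of D N] by blast
  have "asym_cball space3 q3 0 1 \<subseteq> \<Union>(U ` F)"
  proof
    fix v assume v: "v \<in> asym_cball space3 q3 0 1"
    then obtain x y z where xyz: "v = point x y z"
      unfolding asym_cball_def using space3_cases by blast
    have le1: "skew_norm x y z \<le> 1"
      using v by (simp add: xyz point_in_cball_iff)
    then have "(x, y) \<in> D"
      by (simp add: D_def skew_norm_le_1_iff)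
    then obtain p where p: "p \<in> F" "(x, y) \<in> N p"
      using F by blast
    have "skew_norm (x - fst p) (y - snd p) (z - lower_height (fst p) (snd p)) < \<epsilon> p"
      using skew_norm_diff_lower_height_le[OF le1, of "fst p" "snd p"] p(2) by (simp add: N_def t_def)
    then have "v \<in> asym_ball space3 q3 (base p) (\<epsilon> p)"
      by (simp add: asym_ball_def base_def xyz point_linear(2))
    then have "v \<in> U p"
      using ball[of p] F p by blast
    then show "v \<in> \<Union>(U ` F)"
      using p by blast
  qed
  then show "\<exists>\<F>. finite \<F> \<and> \<F> \<subseteq> \<U> \<and> asym_cball space3 q3 0 1 \<subseteq> \<Union>\<F>"
    using F U by (intro exI[of _ "U ` F"]) auto
qed

text \<open>
  A compact set for the norm is bounded, hence bounded in height. But it has to contain the lowest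
  points of the ball, whose heights are unbounded.
\<close>

lemma not_strongly_compact_q3_cball: "\<not> strongly_compact space3 q3 (asym_cball space3 q3 0 1)"
proof
  assume "strongly_compact space3 q3 (asym_cball space3 q3 0 1)"
  then obtain S where comp: "compactin (asym_topology space3 (sym_norm q3)) S"
      and S: "S \<subseteq> asym_cball space3 q3 0 1"
      and cover: "asym_cball space3 q3 0 1 \<subseteq> S + asym_theta space3 q3"
    unfolding strongly_compact_def by blast
  interpret Metric_space space3 "\<lambda>x y. \<bar>sym_norm q3 (y - x)\<bar>"
    by (rule Metric_space_sym_norm[OF asym_normed_space_q3])
  have "compactin mtopology S"
    using comp by (simp add: asym_topology_sym_norm[OF asym_normed_space_q3])
  then have "mbounded S"
    by (rule compactin_imp_mbounded)
  then obtain c K where c: "S \<subseteq> mcball c K"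
    unfolding mbounded_def by blast
  have "\<exists>M. \<forall>x y z. point x y z \<in> S \<longrightarrow> z \<le> M"
  proof (cases "S = {}")
    case False
    with c have "c \<in> space3" by auto
    then obtain a b d where abd: "c = point a b d"
      by (rule space3_cases)
    have "z \<le> 2 * K + d + b + 1" if "point x y z \<in> S" for x y z
    proof -
      have "\<bar>sym_norm q3 (point x y z - c)\<bar> \<le> K"
        using that c by auto
      \<comment> \<open>Upward distances are invisible to \<open>q3 (point x y z - c)\<close>, so the height is bounded through
        the reversed difference.\<close>
      then have "skew_norm (a - x) (b - y) (d - z) \<le> K"
        by (simp add: sym_norm_def abd point_linear(2,3))
      moreover have "0 \<le> sqrt ((a - x)\<^sup>2 + ((b - y - (d - z)) / 2)\<^sup>2)"
        by simp
      ultimately have "- ((b - y + (d - z)) / 2) \<le> K"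
        unfolding skew_norm_def by linarith
      moreover have "skew_norm x y z \<le> 1"
        using S that point_in_cball_iff by blast
      then have "- 1 \<le> y"
        using abs_le_1_if_power4_sum_le_1(2)[of x y] by (auto simp: skew_norm_le_1_iff)
      ultimately show ?thesis
        by (simp add: field_simps)
    qed
    then show ?thesis by blast
  qed simp
  then obtain M where M: "\<And>x y z. point x y z \<in> S \<Longrightarrow> z \<le> M"
    by blast
  obtain x y where xy: "x^4 + y^4 \<le> 1" "M < lower_height x y"
    using lower_height_unbounded by blast
  have "point x y (lower_height x y) \<in> S + asym_theta space3 q3"
    using cover lower_height_in_unit_ball[OF xy(1)] point_in_cball_iff by blast
  then obtain s v where sv: "s \<in> S" "v \<in> asym_theta space3 q3" "point x y (lower_height x y) = s + v"
    by (rule set_plus_elim)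
  \<comment> \<open>The summand \<open>v\<close> is vertical, so \<open>s\<close> lies on the same vertical line as the lowest point.\<close>
  have "v \<in> space3" "q3 v = 0"
    using sv(2) by (simp_all add: asym_theta_def)
  then obtain e where e: "v = point 0 0 e"
    by (metis space3_cases q3_point skew_norm_eq_0_iff)
  have "s = point x y (lower_height x y) - v"
    using sv(3) by simp
  then have s: "s = point x y (lower_height x y - e)"
    by (simp add: e point_linear(2))
  then have "skew_norm x y (lower_height x y - e) \<le> 1"
    using sv(1) S point_in_cball_iff by blast
  then have "lower_height x y \<le> lower_height x y - e"
    using unit_ball_above_tangent lower_height_tangent by metis
  then show False
    using M[of x y "lower_height x y - e"] sv(1) s xy(2) by simp
qed

theorem mainTheorem3:
  shows "\<exists>(X :: (nat \<Rightarrow>\<^sub>0 real) set) (q :: (nat \<Rightarrow>\<^sub>0 real) \<Rightarrow> real).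
     asym_normed_space X q \<and> finite_dimensional X \<and>
     compactin (asym_topology X q) (asym_cball X q 0 1) \<and>
     \<not> strongly_compact X q (asym_cball X q 0 1)"
  using asym_normed_space_q3 finite_dimensional_space3 compactin_q3_cball
    not_strongly_compact_q3_cball by blast

end
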